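(* Let $d$ and $m$ be positive integers. The decorated permutation $\pi$ of a rank $d$ rational Dyck positroid on $[d+m]$ is a $(d+m)$-cycle. Moreover, the set of weak excedances of $\pi$ is $[d]$.
   Context: $[n]=\{1,\dots,n\}$. A rational Dyck path of type $(m,d)$ is a lattice path from $(0,0)$ to $(m,d)$ that only uses unit steps $(1,0)$ or $(0,1)$ and never goes above the line $y=(d/m)x$. A $d\times m$ binary matrix $(a_{i,j})$ is a rational Dyck matrix if its zero entries are separated from its one entries by a vertically-reflected rational Dyck path of type $(m,d)$, with the zeros in the upper-right corner; explicitly, there is a rational Dyck path of type $(m,d)$ such that, if $h_j$ is the height ($y$-coordinate) of its $j$-th horizontal step from the left, then $a_{i,j}=0$ if and only if $i\le h_j$. $\mathcal{D}_{d,m}$ denotes the set of all $d\times m$ rational Dyck matrices. The map $\phi_{d,m}\colon \mathrm{Mat}_{d,m}(\mathbb{R})\to \mathrm{Mat}_{d,d+m}(\mathbb{R})$ sends $A=(a_{i,j})$ to the block matrix $(I_d \mid A')$, where $A'$ is the $d\times m$ matrix with $(i,j)$ entry $(-1)^{d-i}a_{d+1-i,j}$. A positroid of rank $d$ on $[n]$ is a matroid represented by a full-rank real $d\times n$ matrix $A$ with nonnegative maximal minors: its bases are the $B\subseteq[n]$ such that the columns of $A$ indexed by $B$ form a basis of $\mathbb{R}^d$. Matrices in $\phi_{d,m}(\mathcal{D}_{d,m})$ have full rank and nonnegative maximal minors; a rank $d$ rational Dyck positroid on $[d+m]$ is a positroid represented by a matrix in $\phi_{d,m}(\mathcal{D}_{d,m})$.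 For $i\in[n]$ let $\le_i$ be the total order on $[n]$ given by $i\le_i i+1\le_i\dots\le_i n\le_i 1\le_i\dots\le_i i-1$. The Grassmann necklace of a positroid $P$ on $[n]$ is $\mathcal{I}(P)=(I_1,\dots,I_n)$, where $I_i$ is the lexicographically minimal basis of $P$ with respect to $\le_i$ (indices of the $I_i$ are taken modulo $n$). It satisfies: if $i\in I_i$ then $I_{i+1}=(I_i\setminus\{i\})\cup\{j\}$ for some $j\in[n]$; if $i\notin I_i$ then $I_{i+1}=I_i$. A decorated permutation on $n$ letters is a permutation of $[n]$ in which each fixed point $j$ is marked either clockwise ($\underline{j}$) or counterclockwise ($\overline{j}$). The decorated permutation $\pi$ of $P$ is defined by: if $I_{i+1}=(I_i\setminus\{i\})\cup\{j\}$ with $j\neq i$, then $\pi(j)=i$; if $I_{i+1}=I_i$ and $i\notin I_i$, then $\pi(i)=\underline{i}$; if $I_{i+1}=I_i$ and $i\in I_i$, then $\pi(i)=\overline{i}$. A position $j\in[n]$ is a weak excedance of $\pi$ if $j<\pi(j)$ or $\pi(j)=\overline{j}$. *)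

theory Defs
  imports
    Complex_Main
    "HOL-Combinatorics.Cycles"
    "Jordan_Normal_Form.DL_Rank_Submatrix"
begin

section \<open>Rational Dyck matrices\<close>

datatype step = East | North

definition dyck_path :: "nat \<Rightarrow> nat \<Rightarrow> step list \<Rightarrow> bool" where
  "dyck_path m d p \<longleftrightarrow>
     count_list p East = m \<and> count_list p North = d \<and>
     (\<forall>k \<le> length p. real (count_list (take k p) North)
                        \<le> real d / real m * real (count_list (take k p) East))"

text \<open>The heights of the horizontal steps of a path, from left to right, where the
  path starts at height \<open>y\<close>.\<close>

fun east_heights_from :: "nat \<Rightarrow> step list \<Rightarrow> nat list" where
  "east_heights_from y [] = []"
| "east_heights_from y (East # p) = y # east_heights_from y p"
| "east_heights_from y (North # p) = east_heights_from (Suc y) p"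

text \<open>Mathematical indices (rows, columns, ground set elements) start at \<open>1\<close>,
  whereas the indices of lists and of the matrix type start at \<open>0\<close>; hence the shifts
  by one here and below.\<close>

definition east_height :: "step list \<Rightarrow> nat \<Rightarrow> nat" where
  "east_height p j = east_heights_from 0 p ! (j - 1)"

definition dyck_matrices :: "nat \<Rightarrow> nat \<Rightarrow> real mat set" where
  "dyck_matrices d m = {A \<in> carrier_mat d m. \<exists>p. dyck_path m d p \<and>
     (\<forall>i\<in>{1..d}. \<forall>j\<in>{1..m}.
        A $$ (i - 1, j - 1) = (if i \<le> east_height p j then 0 else 1))}"

text \<open>In the right-hand block, row \<open>i = r + 1\<close> of the result is
  \<open>(-1)^(d - i)\<close> times row \<open>d + 1 - i = (d - (r + 1)) + 1\<close> of \<open>A\<close>.\<close>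

definition phi :: "nat \<Rightarrow> nat \<Rightarrow> real mat \<Rightarrow> real mat" where
  "phi d m A = mat d (d + m) (\<lambda>(r, c).
     if c < d then 1\<^sub>m d $$ (r, c)
     else (-1) ^ (d - (r + 1)) * A $$ (d - (r + 1), c - d))"


section \<open>Positroids\<close>

text \<open>A matroid on the ground set \<open>{1..n}\<close> is given by its set of bases.
  Injectivity is needed because a basis of the vector space is a set of vectors, whereas
  the columns indexed by a basis of the matroid are a family.\<close>

definition matroid_of_matrix :: "nat \<Rightarrow> nat \<Rightarrow> real mat \<Rightarrow> nat set set" where
  "matroid_of_matrix d n A = {B. B \<subseteq> {1..n} \<and> inj_on (\<lambda>j. col A (j - 1)) B \<and>
     vectorspace.basis class_ring (module_vec TYPE(real) d) ((\<lambda>j. col A (j - 1)) ` B)}"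

definition nonneg_maximal_minors :: "nat \<Rightarrow> nat \<Rightarrow> real mat \<Rightarrow> bool" where
  "nonneg_maximal_minors d n A \<longleftrightarrow>
     (\<forall>J. J \<subseteq> {0..<n} \<and> card J = d \<longrightarrow> det (submatrix A {0..<d} J) \<ge> 0)"

definition positroid :: "nat \<Rightarrow> nat \<Rightarrow> nat set set \<Rightarrow> bool" where
  "positroid d n P \<longleftrightarrow> (\<exists>A \<in> carrier_mat d n.
     vec_space.rank d A = d \<and> nonneg_maximal_minors d n A \<and> P = matroid_of_matrix d n A)"

definition rational_dyck_positroid :: "nat \<Rightarrow> nat \<Rightarrow> nat set set \<Rightarrow> bool" where
  "rational_dyck_positroid d m P \<longleftrightarrow> positroid d (d + m) P \<and>
     (\<exists>A \<in> phi d m ` dyck_matrices d m. P = matroid_of_matrix d (d + m) A)"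


section \<open>Grassmann necklaces\<close>

text \<open>The position of \<open>a\<close> in the order \<open>i, i + 1, \<dots>, n, 1, \<dots>, i - 1\<close> of \<open>{1..n}\<close>,
  counted from \<open>0\<close>: for \<open>a, b\<close> in \<open>{1..n}\<close>, \<open>a\<close> precedes \<open>b\<close> in the order with
  least element \<open>i\<close> iff its position is smaller.\<close>

definition cyc_pos :: "nat \<Rightarrow> nat \<Rightarrow> nat \<Rightarrow> nat" where
  "cyc_pos n i a = (a + n - i) mod n"

definition lex_le :: "nat \<Rightarrow> nat \<Rightarrow> nat set \<Rightarrow> nat set \<Rightarrow> bool" where
  "lex_le n i B C \<longleftrightarrow> B = C \<or>
     (sorted_key_list_of_set (cyc_pos n i) B, sorted_key_list_of_set (cyc_pos n i) C)
       \<in> lexord {(a, b). cyc_pos n i a < cyc_pos n i b}"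

definition necklace :: "nat \<Rightarrow> nat set set \<Rightarrow> nat \<Rightarrow> nat set" where
  "necklace n P i = (THE B. B \<in> P \<and> (\<forall>C\<in>P. lex_le n i B C))"

definition cyc_succ :: "nat \<Rightarrow> nat \<Rightarrow> nat" where
  "cyc_succ n i = (if i = n then 1 else i + 1)"


section \<open>Decorated permutations\<close>

datatype mark = Clockwise | Counterclockwise

text \<open>A decorated permutation on \<open>n\<close> letters is a pair of a permutation of \<open>{1..n}\<close>
  (the identity elsewhere) and a marking that is defined exactly on its fixed points
  in \<open>{1..n}\<close>.\<close>

type_synonym decorated = "(nat \<Rightarrow> nat) \<times> (nat \<Rightarrow> mark option)"

definition decorated_permutation :: "nat \<Rightarrow> decorated \<Rightarrow> bool" where
  "decorated_permutation n \<pi> \<longleftrightarrow> fst \<pi> permutes {1..n} \<and>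
     (\<forall>j. snd \<pi> j \<noteq> None \<longleftrightarrow> j \<in> {1..n} \<and> fst \<pi> j = j)"

text \<open>In the first rule, \<open>i \<in> I i\<close> has to be required: otherwise the equation would
  hold for all \<open>j \<in> I i\<close> if \<open>i \<notin> I i\<close> and \<open>I\<close> does not change at \<open>i\<close>.\<close>

definition necklace_rules :: "nat \<Rightarrow> (nat \<Rightarrow> nat set) \<Rightarrow> decorated \<Rightarrow> bool" where
  "necklace_rules n I \<pi> \<longleftrightarrow> (\<forall>i\<in>{1..n}.
     (\<forall>j\<in>{1..n}. i \<in> I i \<and> j \<noteq> i \<and> I (cyc_succ n i) = (I i - {i}) \<union> {j}
        \<longrightarrow> fst \<pi> j = i) \<and>
     (I (cyc_succ n i) = I i \<and> i \<notin> I i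
        \<longrightarrow> fst \<pi> i = i \<and> snd \<pi> i = Some Clockwise) \<and>
     (I (cyc_succ n i) = I i \<and> i \<in> I i
        \<longrightarrow> fst \<pi> i = i \<and> snd \<pi> i = Some Counterclockwise))"

definition decorated_permutation_of :: "nat \<Rightarrow> nat set set \<Rightarrow> decorated" where
  "decorated_permutation_of n P =
     (THE \<pi>. decorated_permutation n \<pi> \<and> necklace_rules n (necklace n P) \<pi>)"

definition weak_excedances :: "nat \<Rightarrow> decorated \<Rightarrow> nat set" where
  "weak_excedances n \<pi> =
     {j \<in> {1..n}. j < fst \<pi> j \<or> snd \<pi> j = Some Counterclockwise}"

definition full_cycle :: "nat \<Rightarrow> (nat \<Rightarrow> nat) \<Rightarrow> bool" where
  "full_cycle n \<sigma> \<longleftrightarrow>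
     (\<exists>cs. cycle cs \<and> length cs = n \<and> set cs = {1..n} \<and> \<sigma> = cycle_of_list cs)"

end

theory Submission
  imports Defs
begin

text \<open>
  Let \<open>h\<^sub>j\<close> be the heights of the horizontal steps and \<open>k\<^sub>j = d - h\<^sub>j\<close>. Up to signs, column
  \<open>d + j\<close> of the matrix is the sum of the first \<open>k\<^sub>j\<close> unit vectors. The positroid is therefore the
  cycle matroid of a graph on the vertices \<open>0, \<dots>, d\<close>: column \<open>i \<le> d\<close> is the edge \<open>{i - 1, i}\<close> of a
  path, and column \<open>d + j\<close> is a return edge \<open>{0, k\<^sub>j}\<close>. The Dyck condition gives
  \<open>d = k\<^sub>1 \<ge> k\<^sub>2 \<ge> \<dots> \<ge> k\<^sub>m \<ge> 1\<close>.

  The lexicographically minimal basis for a linear order is the greedy one: it consists of the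
  elements that are not spanned by earlier elements. When the first element \<open>i\<close> is moved to the end
  of the order, the greedy basis loses \<open>i\<close> and gains the element \<open>j\<close> at which the elements after \<open>i\<close>
  first span \<open>i\<close> (\<open>replaced_by_greedy\<close>). So \<open>\<pi> j = i\<close> for this \<open>j\<close>. Both facts hold for every closure
  operator with the exchange property.

  In the graph, \<open>j\<close> is the edge that completes a cycle through \<open>i\<close>. For a path edge \<open>i \<ge> 2\<close> it is the first
  return edge that starts at \<open>i - 1\<close> or, if there is none, the path edge \<open>i - 1\<close>; for \<open>i = 1\<close> it is
  \<open>d + 1\<close>. For a return edge it is the next return edge if that one is parallel to \<open>i\<close>, and otherwise
  the path edge that enters the starting vertex (\<open>successive_path_edge\<close>, \<open>successive_return_edge\<close>,
  \<open>closing_edge\<close>). Hence \<open>\<pi>\<close> runs through the vertices \<open>p = 1, \<dots>, d\<close>: at each \<open>p\<close> it lists the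
  path edge \<open>p\<close> and then the return edges from \<open>p\<close> with decreasing index; from the last element,
  \<open>d + 1\<close>, it goes back to \<open>1\<close>. This is a single cycle, and it increases exactly at the path edges,
  which are the columns \<open>1, \<dots>, d\<close>.
\<close>

section \<open>Greedy bases of a closure operator with the exchange property\<close>

text \<open>A finite matroid, given by its closure operator.\<close>
locale exchange_closure =
  fixes E :: "'a set" and cl :: "'a set \<Rightarrow> 'a set"
  assumes finite_ground: "finite E"
    and closure_subset: "B \<subseteq> E \<Longrightarrow> cl B \<subseteq> E"
    and extensive: "B \<subseteq> E \<Longrightarrow> B \<subseteq> cl B"
    and monotone: "A \<subseteq> B \<Longrightarrow> B \<subseteq> E \<Longrightarrow> cl A \<subseteq> cl B"
    and idempotent: "B \<subseteq> E \<Longrightarrow> cl (cl B) = cl B"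
    and exchange: "B \<subseteq> E \<Longrightarrow> x \<in> E \<Longrightarrow> y \<in> E \<Longrightarrow> x \<in> cl (insert y B) \<Longrightarrow> x \<notin> cl B
      \<Longrightarrow> y \<in> cl (insert x B)"
begin

definition bases :: "'a set set" where
  "bases = {B. B \<subseteq> E \<and> cl B = E \<and> (\<forall>x\<in>B. x \<notin> cl (B - {x}))}"

text \<open>A key \<open>f\<close> that is injective on \<open>E\<close> stands for the linear order in which elements with
  smaller keys come first.\<close>

definition before :: "('a \<Rightarrow> nat) \<Rightarrow> 'a \<Rightarrow> 'a set" where
  "before f a = {b \<in> E. f b < f a}"

definition greedy :: "('a \<Rightarrow> nat) \<Rightarrow> 'a set" where
  "greedy f = {a \<in> E. a \<notin> cl (before f a)}"

lemma before_subset: "before f a \<subseteq> E"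
  by (auto simp: before_def)

lemma greedy_subset: "greedy f \<subseteq> E"
  by (auto simp: greedy_def)

lemma closure_leastI: "A \<subseteq> cl B \<Longrightarrow> B \<subseteq> E \<Longrightarrow> cl A \<subseteq> cl B"
  using monotone[of A "cl B"] closure_subset idempotent by auto

lemma closure_insert_absorb:
  assumes "B \<subseteq> E" "x \<in> cl B"
  shows "cl (insert x B) = cl B"
proof
  show "cl (insert x B) \<subseteq> cl B"
    using assms extensive by (intro closure_leastI) auto
  show "cl B \<subseteq> cl (insert x B)"
    using assms closure_subset by (intro monotone) auto
qed

text \<open>An element that the greedy choice skips is spanned by earlier ones, hence, by induction along
  the order, by earlier chosen ones.\<close>
lemma closure_before_greedy: "cl (before f a) = cl (greedy f \<inter> before f a)"
proof
  have "b \<in> before f a \<Longrightarrow> b \<in> cl (greedy f \<inter> before f a)" for b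
  proof (induction "f b" arbitrary: b rule: less_induct)
    case less
    show ?case
    proof (cases "b \<in> greedy f")
      case True
      then show ?thesis
        using less.prems extensive[of "greedy f \<inter> before f a"] greedy_subset by blast
    next
      case False
      then have "b \<in> cl (before f b)"
        using less.prems by (auto simp: greedy_def before_def)
      moreover have "before f b \<subseteq> cl (greedy f \<inter> before f a)"
        using less by (auto simp: before_def)
      ultimately show ?thesis
        using closure_leastI[of "before f b" "greedy f \<inter> before f a"] greedy_subset by blast
    qed
  qed
  then show "cl (before f a) \<subseteq> cl (greedy f \<inter> before f a)"
    using greedy_subset by (intro closure_leastI) auto
  show "cl (greedy f \<inter> before f a) \<subseteq> cl (before f a)"
    using before_subset by (intro monotone) auto
qed

text \<open>If \<open>x\<close> depended on other chosen elements, take the shortest initial segment of the greedy set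
  in which this happens. By exchange, its last element \<open>y\<close> then depends on \<open>x\<close> and the remaining
  elements of the segment, so the later one of \<open>x\<close> and \<open>y\<close> depends on elements before it and would
  not have been chosen.\<close>
lemma greedy_independent:
  assumes inj: "inj_on f E" and x: "x \<in> greedy f"
  shows "x \<notin> cl (greedy f - {x})"
proof -
  have "x \<notin> cl ({b \<in> greedy f. f b < k} - {x})" for k
  proof (induction k)
    case 0
    show ?case
      using x monotone[of "{}" "before f x"] before_subset by (auto simp: greedy_def)
  next
    case (Suc k)
    let ?B = "{b \<in> greedy f. f b < k} - {x}"
    have B: "?B \<subseteq> E"
      using greedy_subset by auto
    show ?case
    proof (cases "\<exists>y\<in>greedy f. f y = k \<and> y \<noteq> x")
      case True
      then obtain y where y: "y \<in> greedy f" "f y = k" "y \<noteq> x"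
        by blast
      have uniq: "b = y" if "b \<in> greedy f" "f b = k" for b
        using that y inj greedy_subset by (auto simp: inj_on_def)
      have eq: "{b \<in> greedy f. f b < Suc k} - {x} = insert y ?B"
        using y by (auto simp: less_Suc_eq dest: uniq)
      show ?thesis
      proof
        assume "x \<in> cl ({b \<in> greedy f. f b < Suc k} - {x})"
        then have *: "y \<in> cl (insert x ?B)"
          using exchange[OF B, of x y] Suc x y greedy_subset eq by auto
        have "x \<in> E" "y \<in> E"
          using x y(1) greedy_subset by blast+
        then have "f x \<noteq> f y"
          using y(3) inj by (auto simp: inj_on_def)
        show False
        proof (cases "f x < f y")
          case True
          have "insert x ?B \<subseteq> before f y"
            using True y \<open>x \<in> E\<close> greedy_subset by (auto simp: before_def)
          then have "y \<in> cl (before f y)"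
            using * monotone[of "insert x ?B" "before f y"] before_subset by blast
          then show False
            using y by (auto simp: greedy_def)
        next
          case False
          then have "insert y ?B \<subseteq> before f x"
            using y \<open>y \<in> E\<close> \<open>f x \<noteq> f y\<close> greedy_subset by (auto simp: before_def)
          then have "x \<in> cl (before f x)"
            using \<open>x \<in> cl _\<close> eq monotone[of "insert y ?B" "before f x"] before_subset by force
          then show False
            using x by (auto simp: greedy_def)
        qed
      qed
    next
      case False
      then have "{b \<in> greedy f. f b < Suc k} - {x} = ?B"
        by (auto simp: less_Suc_eq)
      then show ?thesis
        using Suc by simp
    qed
  qed
  note bounded = this
  obtain K where K: "\<forall>b\<in>E. f b < K"
    using finite_ground finite_nat_set_iff_bounded[of "f ` E"] by auto
  have "{b \<in> greedy f. f b < K} = greedy f"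
    using K greedy_subset by blast
  then show ?thesis
    using bounded[of K] by simp
qed

lemma greedy_basis:
  assumes "inj_on f E"
  shows "greedy f \<in> bases"
proof -
  have "a \<in> cl (greedy f)" if a: "a \<in> E" for a
  proof (cases "a \<in> greedy f")
    case True
    then show ?thesis
      using extensive greedy_subset by blast
  next
    case False
    then have "a \<in> cl (before f a)"
      using a by (auto simp: greedy_def)
    then show ?thesis
      using closure_before_greedy[of f a] monotone[of "greedy f \<inter> before f a" "greedy f"]
        greedy_subset by auto
  qed
  then have "cl (greedy f) = E"
    using closure_subset[OF greedy_subset[of f]] by blast
  then show ?thesis
    unfolding bases_def using greedy_independent[OF assms] greedy_subset[of f]
    by (intro CollectI conjI ballI)
qed

lemma basis_subset: "B \<in> bases \<Longrightarrow> B \<subseteq> E"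
  by (simp add: bases_def)

text \<open>This is the combinatorial form of lexicographic minimality. Let \<open>x\<close> be the first element in
  which \<open>C\<close> and the greedy set differ. It cannot lie in \<open>C\<close> only, for then the part of \<open>C\<close> before
  \<open>x\<close>, which equals that of the greedy set, would already span \<open>x\<close>. So \<open>x\<close> is chosen greedily, and
  \<open>C\<close> must continue after \<open>x\<close>, since its part before \<open>x\<close> does not span \<open>x\<close>.\<close>
lemma greedy_first_difference:
  assumes inj: "inj_on f E" and C: "C \<in> bases" "C \<noteq> greedy f"
  obtains x y where "x \<in> greedy f" "x \<notin> C" "y \<in> C" "f x < f y"
    "\<And>z. z \<in> C \<Longrightarrow> z \<notin> greedy f \<Longrightarrow> f x < f z"
proof -
  have CE: "C \<subseteq> E"
    using C(1) by (rule basis_subset)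
  let ?D = "(C - greedy f) \<union> (greedy f - C)"
  have "?D \<noteq> {}" "?D \<subseteq> E"
    using C(2) CE greedy_subset by auto
  moreover from this have "finite ?D"
    using finite_ground finite_subset by blast
  ultimately obtain x where x: "x \<in> ?D" "\<And>z. z \<in> ?D \<Longrightarrow> f x \<le> f z"
    by (metis arg_min_least arg_min_if_finite(1))
  have xE: "x \<in> E"
    using x CE greedy_subset by auto
  have same: "greedy f \<inter> before f x = C \<inter> before f x"
    using x(2) by (auto simp: before_def not_less[symmetric])
  have "x \<in> greedy f"
  proof (rule ccontr)
    assume "x \<notin> greedy f"
    then have "x \<in> C" "x \<in> cl (before f x)"
      using x(1) xE by (auto simp: greedy_def)
    then have "x \<in> cl (C \<inter> before f x)"
      using closure_before_greedy[of f x] same by simp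
    moreover have "C \<inter> before f x \<subseteq> C - {x}"
      by (auto simp: before_def)
    ultimately have "x \<in> cl (C - {x})"
      using monotone[of "C \<inter> before f x" "C - {x}"] CE by auto
    then show False
      using C(1) \<open>x \<in> C\<close> by (auto simp: bases_def)
  qed
  then have xC: "x \<notin> C"
    using x(1) by auto
  have "\<exists>y\<in>C. f x < f y"
  proof (rule ccontr)
    assume no: "\<not> ?thesis"
    have "f y < f x" if "y \<in> C" for y
      using no that xC CE xE inj by (metis inj_on_def linorder_neqE_nat subsetD)
    then have "C \<subseteq> before f x"
      using CE by (auto simp: before_def)
    moreover have "x \<in> cl C"
      using C(1) xE by (auto simp: bases_def)
    ultimately have "x \<in> cl (before f x)"
      using monotone[of C "before f x"] before_subset by blast
    then show False
      using \<open>x \<in> greedy f\<close> by (auto simp: greedy_def)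
  qed
  moreover have "f x < f z" if "z \<in> C" "z \<notin> greedy f" for z
  proof -
    have "f x \<le> f z"
      using x(2) that by auto
    moreover have "f x \<noteq> f z"
      using inj xE that CE xC by (auto simp: inj_on_def)
    ultimately show ?thesis
      by simp
  qed
  ultimately show thesis
    using that \<open>x \<in> greedy f\<close> xC by blast
qed

text \<open>\<open>j\<close> is the element at which the elements other than \<open>i\<close>, taken in the order of \<open>f\<close>, begin to
  span \<open>i\<close>.\<close>
definition replaced_by :: "('a \<Rightarrow> nat) \<Rightarrow> 'a \<Rightarrow> 'a \<Rightarrow> bool" where
  "replaced_by f i j \<longleftrightarrow> i \<in> cl {b \<in> E. b \<noteq> i \<and> f b \<le> f j} \<and> i \<notin> cl {b \<in> E. b \<noteq> i \<and> f b < f j}"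

text \<open>What one step of the necklace does: \<open>f\<close> orders \<open>E\<close> with \<open>i\<close> first, and \<open>g\<close> is the same order
  with \<open>i\<close> moved to the end. An element \<open>a \<noteq> i\<close> is treated differently by the two greedy choices iff
  it is spanned by its predecessors together with \<open>i\<close> but not without \<open>i\<close>. By exchange, this says
  that \<open>a\<close> is the element which makes \<open>i\<close> spanned, so that \<open>a = j\<close>.\<close>
lemma replaced_by_greedy:
  assumes inj: "inj_on f E"
    and i: "i \<in> E" and j: "j \<in> E" "j \<noteq> i"
    and first: "\<And>b. b \<in> E \<Longrightarrow> b \<noteq> i \<Longrightarrow> f i < f b"
    and last: "\<And>b. b \<in> E \<Longrightarrow> b \<noteq> i \<Longrightarrow> g b < g i"
    and same: "\<And>a b. a \<in> E \<Longrightarrow> b \<in> E \<Longrightarrow> a \<noteq> i \<Longrightarrow> b \<noteq> i \<Longrightarrow> g a < g b \<longleftrightarrow> f a < f b"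
    and repl: "replaced_by f i j"
  shows "i \<in> greedy f" and "j \<notin> greedy f" and "greedy g = greedy f - {i} \<union> {j}"
proof -
  define B where "B a = {b \<in> E. b \<noteq> i \<and> f b < f a}" for a
  have BE: "B a \<subseteq> E" for a
    by (auto simp: B_def)
  have f_before: "before f a = insert i (B a)" if "a \<in> E" "a \<noteq> i" for a
    using that i first by (auto simp: before_def B_def)
  have g_before: "before g a = B a" if "a \<in> E" "a \<noteq> i" for a
    using that same last by (auto simp: before_def B_def dest: less_asym)
  have ins: "{b \<in> E. b \<noteq> i \<and> f b \<le> f j} = insert j (B j)"
    using j inj by (auto simp: B_def le_less inj_on_def)
  have in_cl: "i \<in> cl (insert j (B j))" and notin_cl: "i \<notin> cl (B j)"
    using repl ins by (auto simp: replaced_by_def B_def)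
  have "before f i = {}"
    using first by (force simp: before_def)
  then show i_f: "i \<in> greedy f"
    using i notin_cl monotone[of "{}" "B j"] BE by (auto simp: greedy_def)
  have "j \<in> cl (insert i (B j))"
    using exchange[OF BE i j(1)] in_cl notin_cl by blast
  then show j_f: "j \<notin> greedy f"
    using f_before[OF j] by (auto simp: greedy_def)
  have i_g: "i \<notin> greedy g"
  proof -
    have "insert j (B j) \<subseteq> before g i"
      using j last by (auto simp: before_def B_def)
    then show ?thesis
      using in_cl monotone[of "insert j (B j)" "before g i"] before_subset by (auto simp: greedy_def)
  qed
  have j_g: "j \<in> greedy g"
  proof (rule ccontr)
    assume "j \<notin> greedy g"
    then have "j \<in> cl (B j)"
      using j g_before by (auto simp: greedy_def)
    then show False
      using closure_insert_absorb[OF BE] in_cl notin_cl by blast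
  qed
  have other: "a \<in> greedy g \<longleftrightarrow> a \<in> greedy f" if a: "a \<in> E" "a \<noteq> i" "a \<noteq> j" for a
  proof -
    have "a \<in> cl (insert i (B a)) \<longleftrightarrow> a \<in> cl (B a)"
    proof
      assume "a \<in> cl (B a)"
      then show "a \<in> cl (insert i (B a))"
        using monotone[of "B a" "insert i (B a)"] BE i by auto
    next
      assume ins: "a \<in> cl (insert i (B a))"
      consider "f a < f j" | "f j < f a"
        using a j inj by (metis inj_on_def linorder_neqE_nat)
      then show "a \<in> cl (B a)"
      proof cases
        case 1
        show ?thesis
        proof (rule ccontr)
          assume "a \<notin> cl (B a)"
          then have "i \<in> cl (insert a (B a))"
            using exchange[OF BE a(1) i] ins by blast
          moreover have "insert a (B a) \<subseteq> B j"
            using 1 a by (auto simp: B_def)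
          ultimately show False
            using notin_cl monotone[of "insert a (B a)" "B j"] BE by blast
        qed
      next
        case 2
        then have "insert j (B j) \<subseteq> B a"
          using j by (auto simp: B_def)
        then have "i \<in> cl (B a)"
          using in_cl monotone[of "insert j (B j)" "B a"] BE by blast
        then show ?thesis
          using closure_insert_absorb[OF BE] ins by blast
      qed
    qed
    then show ?thesis
      using a f_before g_before by (auto simp: greedy_def)
  qed
  show "greedy g = greedy f - {i} \<union> {j}"
    using i_f j_f i_g j_g other greedy_subset[of f] greedy_subset[of g] by blast
qed

end


section \<open>Necklaces and decorated permutations of greedy bases\<close>

text \<open>Where the lists first differ, \<open>xs\<close> has an element up to \<open>x\<close>, and \<open>ys\<close> has a larger one, because
  all elements that occur in \<open>ys\<close> only come after \<open>x\<close>. The element \<open>y\<close> ensures that \<open>ys\<close> does not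
  end there, which would make it the smaller list.\<close>
lemma lexord_first_difference:
  assumes "sorted_wrt (\<lambda>a b. f a < f b) xs" "sorted_wrt (\<lambda>a b. f a < f b) ys"
    and "x \<in> set xs" "x \<notin> set ys" "y \<in> set ys" "f x < f y"
    and "\<And>z. z \<in> set ys \<Longrightarrow> z \<notin> set xs \<Longrightarrow> f x < f z"
  shows "(xs, ys) \<in> lexord {(a, b). f a < (f b :: nat)}"
  using assms
proof (induction xs arbitrary: ys)
  case (Cons a xs)
  then obtain b zs where ys: "ys = b # zs"
    by (cases ys) auto
  have ax: "f a \<le> f x"
    using Cons.prems by auto
  show ?case
  proof (cases "a = b")
    case True
    then have "(xs, zs) \<in> lexord {(a, b). f a < f b}"
    proof (intro Cons.IH)
      show "x \<in> set xs"
        using Cons.prems ys True by auto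
      then have "f a < f x"
        using Cons.prems by auto
      then show "y \<in> set zs"
        using Cons.prems ys True by auto
      show "f x < f z" if "z \<in> set zs" "z \<notin> set xs" for z
        using Cons.prems(7)[of z] Cons.prems(2) ys True that by auto
    qed (use Cons.prems ys in auto)
    then show ?thesis
      using ys True by simp
  next
    case False
    have "f a < f b"
    proof (cases "b \<in> set xs")
      case True
      then show ?thesis
        using Cons.prems(1) by auto
    next
      case False
      then have "f x < f b"
        using Cons.prems(7)[of b] ys \<open>a \<noteq> b\<close> by auto
      then show ?thesis
        using ax by simp
    qed
    then show ?thesis
      using ys by simp
  qed
qed simp

lemma (in linorder) sorted_key_list_of_set_strict:
  fixes f :: "'b \<Rightarrow> 'a"
  assumes "inj_on f A" "finite A"
  shows "set (sorted_key_list_of_set f A) = A"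
    and "sorted_wrt (\<lambda>a b. f a < f b) (sorted_key_list_of_set f A)"
proof -
  interpret folding_insort_key "(\<le>)" "(<)" A f
    using assms by unfold_locales
  show "set (sorted_key_list_of_set f A) = A"
    using assms by simp
  show "sorted_wrt (\<lambda>a b. f a < f b) (sorted_key_list_of_set f A)"
    using strict_sorted_key_list_of_set[of A] by (simp add: sorted_wrt_map)
qed

lemma cyc_pos_eq:
  assumes "i \<in> {1..n}" "a \<in> {1..n}"
  shows "cyc_pos n i a = (if i \<le> a then a - i else a + n - i)"
proof (cases "i \<le> a")
  case True
  then have "a + n - i = n + (a - i)"
    by simp
  moreover have "a - i < n"
    using assms by auto
  ultimately have "cyc_pos n i a = a - i"
    by (simp only: cyc_pos_def mod_add_self1 mod_less)
  then show ?thesis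
    using True by simp
qed (use assms in \<open>auto simp: cyc_pos_def\<close>)

lemma inj_on_cyc_pos: "i \<in> {1..n} \<Longrightarrow> inj_on (cyc_pos n i) {1..n}"
  by (rule inj_onI) (auto simp: cyc_pos_eq split: if_splits)

lemma lex_le_antisym:
  assumes "lex_le n i B C" "lex_le n i C B" shows "B = C"
proof (rule ccontr)
  assume "B \<noteq> C"
  moreover have "asym {(a, b). cyc_pos n i a < cyc_pos n i b}"
    by (auto intro: asymI)
  ultimately show False
    using assms lexord_asym asymD unfolding lex_le_def by metis
qed

lemma nth_cycle_of_list:
  assumes "distinct cs" "t < length cs"
  shows "cycle_of_list cs (cs ! t) = cs ! (Suc t mod length cs)"
proof -
  have "map (cycle_of_list cs) cs ! t = rotate1 cs ! t"
    using cyclic_rotation[OF assms(1), of 1] by simp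
  then show ?thesis
    using assms(2) by (simp add: nth_rotate1)
qed

locale cyclic_exchange_closure = exchange_closure "{1..n}" cl for n :: nat and cl
begin

(* Rewriting the ground set {1..n} to {Suc 0..n} would hide it from the facts of the locale. *)
context
  notes One_nat_def [simp del]
begin

lemma necklace_eq_greedy:
  assumes i: "i \<in> {1..n}"
  shows "necklace n bases i = greedy (cyc_pos n i)"
proof -
  let ?f = "cyc_pos n i"
  have inj: "inj_on ?f {1..n}"
    using i by (rule inj_on_cyc_pos)
  have list: "set (sorted_key_list_of_set ?f B) = B"
    "sorted_wrt (\<lambda>a b. ?f a < ?f b) (sorted_key_list_of_set ?f B)" if "B \<subseteq> {1..n}" for B
    using sorted_key_list_of_set_strict[of ?f B] inj_on_subset[OF inj that] finite_subset[OF that]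
    by auto
  have least: "lex_le n i (greedy ?f) C" if C: "C \<in> bases" for C
  proof (cases "C = greedy ?f")
    case False
    obtain x y where xy: "x \<in> greedy ?f" "x \<notin> C" "y \<in> C" "?f x < ?f y"
      "\<And>z. z \<in> C \<Longrightarrow> z \<notin> greedy ?f \<Longrightarrow> ?f x < ?f z"
      using greedy_first_difference[OF inj C False] by blast
    have CE: "C \<subseteq> {1..n}"
      using C by (rule basis_subset)
    show ?thesis
      unfolding lex_le_def using xy
      by (intro disjI2 lexord_first_difference[where x = x and y = y])
        (simp_all add: list[OF CE] list[OF greedy_subset])
  qed (simp add: lex_le_def)
  show ?thesis
    unfolding necklace_def
  proof (rule the_equality)
    show "greedy ?f \<in> bases \<and> (\<forall>C\<in>bases. lex_le n i (greedy ?f) C)"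
      using least greedy_basis[OF inj] by blast
    show "B = greedy ?f" if "B \<in> bases \<and> (\<forall>C\<in>bases. lex_le n i B C)" for B
      using that least greedy_basis[OF inj] lex_le_antisym by blast
  qed
qed

lemma necklace_step:
  assumes i: "i \<in> {1..n}" and j: "j \<in> {1..n}" "j \<noteq> i"
    and repl: "replaced_by (cyc_pos n i) i j"
  shows "i \<in> necklace n bases i" and "j \<notin> necklace n bases i"
    and "necklace n bases (cyc_succ n i) = necklace n bases i - {i} \<union> {j}"
proof -
  let ?f = "cyc_pos n i" and ?g = "cyc_pos n (cyc_succ n i)"
  have succ: "cyc_succ n i \<in> {1..n}"
    using i by (auto simp: cyc_succ_def)
  have first: "?f i < ?f b" if "b \<in> {1..n}" "b \<noteq> i" for b
    using that i by (auto simp: cyc_pos_eq)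
  have last: "?g b < ?g i" if "b \<in> {1..n}" "b \<noteq> i" for b
    using that i unfolding cyc_pos_eq[OF succ that(1)] cyc_pos_eq[OF succ i]
    by (auto simp: cyc_succ_def)
  have same: "?g a < ?g b \<longleftrightarrow> ?f a < ?f b"
    if "a \<in> {1..n}" "b \<in> {1..n}" "a \<noteq> i" "b \<noteq> i" for a b
    using that i unfolding cyc_pos_eq[OF succ that(1)] cyc_pos_eq[OF succ that(2)]
      cyc_pos_eq[OF i that(1)] cyc_pos_eq[OF i that(2)]
    by (auto simp: cyc_succ_def)
  note * = replaced_by_greedy[where f = ?f and g = ?g, OF inj_on_cyc_pos[OF i] i j first last same repl]
  show "i \<in> necklace n bases i" "j \<notin> necklace n bases i"
    "necklace n bases (cyc_succ n i) = necklace n bases i - {i} \<union> {j}"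
    unfolding necklace_eq_greedy[OF i] necklace_eq_greedy[OF succ] using * by simp_all
qed

text \<open>The cycle maps each \<open>cs ! t\<close> to its successor in \<open>cs\<close>, and the necklace rules ask for
  \<open>\<pi> j = i\<close> whenever \<open>j\<close> replaces \<open>i\<close>. Since \<open>cs\<close> exhausts the ground set, the rules determine the
  permutation, and as it has no fixed points there is nothing to mark.\<close>
lemma decorated_permutation_of_cycle:
  assumes cs: "distinct cs" "set cs = {1..n}" and n: "2 \<le> n"
    and repl: "\<And>t. t < n \<Longrightarrow>
      replaced_by (cyc_pos n (cs ! (Suc t mod n))) (cs ! (Suc t mod n)) (cs ! t)"
  shows "decorated_permutation_of n bases = (cycle_of_list cs, \<lambda>_. None)"
proof -
  let ?\<sigma> = "cycle_of_list cs" and ?I = "necklace n bases"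
  have len: "length cs = n"
    using cs distinct_card by fastforce
  have perm: "?\<sigma> permutes {1..n}"
    using cycle_permutes[of cs] cs by simp
  have moved: "?\<sigma> j \<noteq> j" and repl_\<sigma>: "replaced_by (cyc_pos n (?\<sigma> j)) (?\<sigma> j) j"
    if "j \<in> {1..n}" for j
  proof -
    have "j \<in> set cs"
      using that cs(2) by simp
    then obtain t where t: "t < n" "j = cs ! t"
      using len by (auto simp: in_set_conv_nth)
    have \<sigma>: "?\<sigma> j = cs ! (Suc t mod n)"
      using nth_cycle_of_list[of cs t] cs t len by simp
    have "Suc t mod n \<noteq> t"
      using t n by (cases "Suc t = n") auto
    then show "?\<sigma> j \<noteq> j"
      using \<sigma> t cs len n by (simp add: nth_eq_iff_index_eq)
    show "replaced_by (cyc_pos n (?\<sigma> j)) (?\<sigma> j) j"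
      using repl[OF t(1)] \<sigma> t by simp
  qed
  have \<sigma>_in: "?\<sigma> j \<in> {1..n}" if "j \<in> {1..n}" for j
    using perm that by (simp only: permutes_in_image)
  have step: "?\<sigma> j \<in> ?I (?\<sigma> j)" "j \<notin> ?I (?\<sigma> j)"
    "?I (cyc_succ n (?\<sigma> j)) = ?I (?\<sigma> j) - {?\<sigma> j} \<union> {j}" if "j \<in> {1..n}" for j
    using necklace_step[OF \<sigma>_in[OF that] that moved[OF that, symmetric] repl_\<sigma>[OF that]] by simp_all
  have surj: "\<exists>j\<in>{1..n}. i = ?\<sigma> j" if "i \<in> {1..n}" for i
    using permutes_image[OF perm] that by auto
  show ?thesis
    unfolding decorated_permutation_of_def
  proof (rule the_equality)
    have "decorated_permutation n (?\<sigma>, \<lambda>_. None)"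
      using perm moved by (auto simp: decorated_permutation_def)
    moreover have "necklace_rules n ?I (?\<sigma>, \<lambda>_. None)"
      unfolding necklace_rules_def
    proof
      fix i assume "i \<in> {1..n}"
      then obtain j where j: "j \<in> {1..n}" "i = ?\<sigma> j"
        using surj by blast
      note i_step = step[OF j(1), folded j(2)]
      have unique: "j' = j" if "?I (cyc_succ n i) = (?I i - {i}) \<union> {j'}" for j'
        using i_step(2,3) that by blast
      have changed: "?I (cyc_succ n i) \<noteq> ?I i"
        using i_step(2,3) by blast
      have "fst (?\<sigma>, \<lambda>_. None) j' = i" if "?I (cyc_succ n i) = (?I i - {i}) \<union> {j'}" for j'
        using unique[OF that] j(2) by simp
      with changed show "(\<forall>j\<in>{1..n}. i \<in> ?I i \<and> j \<noteq> i \<and> ?I (cyc_succ n i) = (?I i - {i}) \<union> {j}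
            \<longrightarrow> fst (?\<sigma>, \<lambda>_. None) j = i) \<and>
          (?I (cyc_succ n i) = ?I i \<and> i \<notin> ?I i
            \<longrightarrow> fst (?\<sigma>, \<lambda>_. None) i = i \<and> snd (?\<sigma>, \<lambda>_. None) i = Some Clockwise) \<and>
          (?I (cyc_succ n i) = ?I i \<and> i \<in> ?I i
            \<longrightarrow> fst (?\<sigma>, \<lambda>_. None) i = i \<and> snd (?\<sigma>, \<lambda>_. None) i = Some Counterclockwise)"
        by blast
    qed
    ultimately show "decorated_permutation n (?\<sigma>, \<lambda>_. None) \<and> necklace_rules n ?I (?\<sigma>, \<lambda>_. None)" ..
  next
    fix \<pi> assume \<pi>: "decorated_permutation n \<pi> \<and> necklace_rules n ?I \<pi>"
    have val: "fst \<pi> j = ?\<sigma> j" if "j \<in> {1..n}" for j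
    proof -
      have "\<forall>j'\<in>{1..n}. ?\<sigma> j \<in> ?I (?\<sigma> j) \<and> j' \<noteq> ?\<sigma> j \<and>
          ?I (cyc_succ n (?\<sigma> j)) = (?I (?\<sigma> j) - {?\<sigma> j}) \<union> {j'} \<longrightarrow> fst \<pi> j' = ?\<sigma> j"
        using bspec[OF \<pi>[THEN conjunct2, unfolded necklace_rules_def] \<sigma>_in[OF that]]
        by (rule conjunct1)
      then show ?thesis
        using step[OF that] moved[OF that, symmetric] that by blast
    qed
    have "fst \<pi> j = ?\<sigma> j" for j
      using val permutes_not_in[OF perm] permutes_not_in[of "fst \<pi>" "{1..n}"] \<pi>
      unfolding decorated_permutation_def by metis
    then have "fst \<pi> = ?\<sigma>" by blast
    moreover have "snd \<pi> j = None" for j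
    proof (rule ccontr)
      assume "snd \<pi> j \<noteq> None"
      then have "j \<in> {1..n}" "fst \<pi> j = j"
        using \<pi> unfolding decorated_permutation_def by blast+
      then show False
        using val moved by auto
    qed
    ultimately show "\<pi> = (?\<sigma>, \<lambda>_. None)"
      by (auto simp: prod_eq_iff)
  qed
qed

end

end


section \<open>The matroid of the columns of a matrix\<close>

context vec_space
begin

definition column_closure :: "'b set \<Rightarrow> ('b \<Rightarrow> 'a vec) \<Rightarrow> 'b set \<Rightarrow> 'b set" where
  "column_closure E v B = {a \<in> E. v a \<in> span (v ` B)}"

lemma span_least:
  assumes "W \<subseteq> carrier_vec n" "U \<subseteq> span W"
  shows "span U \<subseteq> span W"
  using span_is_monotone[OF assms(2)] span_span[OF assms(1)] by simp

text \<open>In \<open>x = c y + w\<close> with \<open>w\<close> in the span of \<open>W\<close>, the coefficient \<open>c\<close> cannot vanish, so the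
  equation can be solved for \<open>y\<close>.\<close>
lemma span_exchange:
  assumes W: "finite W" "W \<subseteq> carrier_vec n" and x: "x \<in> carrier_vec n" and y: "y \<in> carrier_vec n"
    and x_in: "x \<in> span (insert y W)" and x_notin: "x \<notin> span W"
  shows "y \<in> span (insert x W)"
proof -
  have "y \<notin> W"
    using x_in x_notin by (auto simp: insert_absorb)
  obtain a where "lincomb a (insert y W) = x"
    using finite_in_span[OF _ _ x_in] W y by auto
  moreover define w where "w = lincomb a W"
  ultimately have x_eq: "x = a y \<cdot>\<^sub>v y + w"
    using lincomb_insert2[OF W _ \<open>y \<notin> W\<close> y, of a] by simp
  have w: "w \<in> span W"
    using W(1) by (auto simp: w_def)
  then have "w \<in> carrier_vec n"
    using span_is_subset2[of W] W by auto
  have "a y \<noteq> 0"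
  proof
    assume "a y = 0"
    then have "x = w"
      using x_eq y \<open>w \<in> carrier_vec n\<close> by (auto intro!: eq_vecI)
    then show False
      using w x_notin by simp
  qed
  have xW: "insert x W \<subseteq> carrier_vec n"
    using W x by simp
  have y_eq: "y = (1 / a y) \<cdot>\<^sub>v x + (- (1 / a y)) \<cdot>\<^sub>v w"
    using x_eq y \<open>w \<in> carrier_vec n\<close> \<open>a y \<noteq> 0\<close> by (auto intro!: eq_vecI simp: field_simps)
  have "x \<in> span (insert x W)" "w \<in> span (insert x W)"
    using in_own_span[of "insert x W"] span_is_monotone[of W "insert x W"] xW w by auto
  then have "(1 / a y) \<cdot>\<^sub>v x + (- (1 / a y)) \<cdot>\<^sub>v w \<in> span (insert x W)"
    using span_add1[of "insert x W", OF _ smult_in_span[OF xW] smult_in_span[OF xW]] xW by simp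
  then show ?thesis
    by (simp only: y_eq[symmetric])
qed

lemma exchange_closure_columns:
  assumes fin: "finite E" and v: "v ` E \<subseteq> carrier_vec n"
  shows "exchange_closure E (column_closure E v)"
proof
  show "finite E" by fact
next
  fix B assume B: "B \<subseteq> E"
  have vB: "v ` B \<subseteq> carrier_vec n"
    using B v by blast
  show "column_closure E v B \<subseteq> E"
    by (auto simp: column_closure_def)
  show "B \<subseteq> column_closure E v B"
    using B in_own_span[of "v ` B"] vB by (auto simp: column_closure_def)
  have "span (v ` column_closure E v B) \<subseteq> span (v ` B)"
    using vB by (intro span_least) (auto simp: column_closure_def)
  moreover have "span (v ` B) \<subseteq> span (v ` column_closure E v B)"
    using \<open>B \<subseteq> column_closure E v B\<close> by (intro span_is_monotone) auto
  ultimately show "column_closure E v (column_closure E v B) = column_closure E v B"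
    by (auto simp: column_closure_def)
next
  fix A B :: "'b set" assume "A \<subseteq> B" "B \<subseteq> E"
  then show "column_closure E v A \<subseteq> column_closure E v B"
    using span_is_monotone[of "v ` A" "v ` B"] by (auto simp: column_closure_def)
next
  fix B x y assume *: "B \<subseteq> E" "x \<in> E" "y \<in> E" "x \<in> column_closure E v (insert y B)"
    "x \<notin> column_closure E v B"
  have carr: "v ` B \<subseteq> carrier_vec n" "v x \<in> carrier_vec n" "v y \<in> carrier_vec n"
    using * v by auto
  have x_in: "v x \<in> span (insert (v y) (v ` B))" and x_notin: "v x \<notin> span (v ` B)"
    using * by (auto simp: column_closure_def)
  have "v y \<in> span (insert (v x) (v ` B))"
    using span_exchange[of "v ` B" "v x" "v y"] * carr x_in x_notin fin finite_subset by blast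
  then show "y \<in> column_closure E v (insert x B)"
    using * by (auto simp: column_closure_def)
qed

text \<open>Independence of the indices covers both injectivity and linear independence of the set of vectors,
  because of two indices with equal vectors each is in the closure of the other.\<close>
lemma basis_iff_column_closure_basis:
  assumes fin: "finite E" and v: "v ` E \<subseteq> carrier_vec n" and gen: "span (v ` E) = carrier_vec n"
  shows "{B. B \<subseteq> E \<and> inj_on v B \<and> basis (v ` B)} =
    exchange_closure.bases E (column_closure E v)"
proof -
  interpret exchange_closure E "column_closure E v"
    by (rule exchange_closure_columns[OF fin v])
  have "inj_on v B \<and> basis (v ` B) \<longleftrightarrow>
      column_closure E v B = E \<and> (\<forall>x\<in>B. x \<notin> column_closure E v (B - {x}))" if B: "B \<subseteq> E" for B
  proof -
    have vB: "v ` B \<subseteq> carrier_vec n" and finB: "finite (v ` B)"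
      using B v fin finite_subset by blast+
    have "span (v ` B) = carrier_vec n \<longleftrightarrow> column_closure E v B = E"
    proof
      assume "span (v ` B) = carrier_vec n"
      then show "column_closure E v B = E"
        using v by (auto simp: column_closure_def)
    next
      assume "column_closure E v B = E"
      then have "v ` E \<subseteq> span (v ` B)"
        by (auto simp: column_closure_def)
      then show "span (v ` B) = carrier_vec n"
        using span_least[OF vB, of "v ` E"] span_is_subset2[of "v ` B"] vB gen by auto
    qed
    moreover have "inj_on v B \<and> lin_indpt (v ` B) \<longleftrightarrow> (\<forall>x\<in>B. x \<notin> column_closure E v (B - {x}))"
    proof
      assume indep: "inj_on v B \<and> lin_indpt (v ` B)"
      show "\<forall>x\<in>B. x \<notin> column_closure E v (B - {x})"
      proof
        fix x assume x: "x \<in> B"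
        then have "v ` (B - {x}) = v ` B - {v x}"
          using indep by (auto simp: inj_on_def)
        moreover have "v x \<notin> span (v ` B - {v x})"
          using lindep_span[of "v ` B"] vB finB indep x by auto
        ultimately show "x \<notin> column_closure E v (B - {x})"
          by (simp add: column_closure_def)
      qed
    next
      assume "\<forall>x\<in>B. x \<notin> column_closure E v (B - {x})"
      then have notin: "v x \<notin> span (v ` (B - {x}))" if "x \<in> B" for x
        using that B by (auto simp: column_closure_def)
      have inj: "inj_on v B"
      proof (rule inj_onI, rule ccontr)
        fix x y assume xy: "x \<in> B" "y \<in> B" "v x = v y" "x \<noteq> y"
        then have "v x \<in> v ` (B - {x})"
          by auto
        moreover have "v ` (B - {x}) \<subseteq> carrier_vec n"
          using vB by blast
        ultimately show False
          using in_own_span[of "v ` (B - {x})"] notin[OF xy(1)] by auto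
      qed
      moreover have "v x \<notin> span (v ` B - {v x})" if "x \<in> B" for x
      proof -
        have "v ` (B - {x}) = v ` B - {v x}"
          using inj that by (auto simp: inj_on_def)
        then show ?thesis
          using notin[OF that] by simp
      qed
      ultimately show "inj_on v B \<and> lin_indpt (v ` B)"
        using lindep_span[of "v ` B"] vB finB by auto
    qed
    ultimately show ?thesis
      using vB by (auto simp: basis_def)
  qed
  then show ?thesis
    unfolding bases_def by blast
qed

end

lemma matroid_of_matrix_eq_bases:
  assumes A: "A \<in> carrier_mat d n"
    and v: "\<And>j. j \<in> {1..n} \<Longrightarrow> col A (j - 1) = v j"
    and gen: "LinearCombinations.module.span class_ring (module_vec TYPE(real) d) (v ` {1..n}) = carrier_vec d"
  shows "matroid_of_matrix d n A =
    exchange_closure.bases {1..n} (vec_space.column_closure d {1..n} v)"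
proof -
  interpret vec_space "TYPE(real)" d .
  have carr: "v ` {1..n} \<subseteq> carrier_vec d"
    using A v by (auto simp flip: v)
  have "inj_on (\<lambda>j. col A (j - 1)) B \<longleftrightarrow> inj_on v B" "(\<lambda>j. col A (j - 1)) ` B = v ` B"
    if "B \<subseteq> {1..n}" for B
    using that v by (auto intro!: inj_on_cong image_cong)
  then have "matroid_of_matrix d n A = {B. B \<subseteq> {1..n} \<and> inj_on v B \<and> basis (v ` B)}"
    unfolding matroid_of_matrix_def by auto
  then show ?thesis
    using basis_iff_column_closure_basis[OF _ carr gen] by simp
qed


section \<open>The columns of a Dyck matrix as edges of a graph\<close>

text \<open>The column \<open>d + j\<close> has its nonzero entries in the first \<open>k j\<close> rows. Read the first \<open>d\<close> columns,
  up to sign, as the edges \<open>{i - 1, i}\<close> of the path with vertices \<open>0, \<dots>, d\<close>. The column \<open>d + j\<close> is the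
  signed sum of the first \<open>k j\<close> of them and hence the edge \<open>{0, k j}\<close>: a return edge from \<open>k j\<close>
  to \<open>0\<close>. Linear dependence of columns is thus dependence in the cycle matroid of this graph.\<close>
locale dyck_columns = vec_space "TYPE(real)" d for d :: nat +
  fixes m :: nat and k :: "nat \<Rightarrow> nat"
  assumes d_pos: "1 \<le> d" and m_pos: "1 \<le> m"
    and k_first: "k 1 = d"
    and k_range: "j \<in> {1..m} \<Longrightarrow> 1 \<le> k j \<and> k j \<le> d"
    and k_antimono: "i \<in> {1..m} \<Longrightarrow> j \<in> {1..m} \<Longrightarrow> i \<le> j \<Longrightarrow> k j \<le> k i"
begin

text \<open>The vector that the graph assigns to vertex \<open>p\<close>; a path edge is the difference of the vectors of
  its ends up to sign. Hence \<open>potential p\<close> lies in the span of a set of edges as soon as these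
  connect \<open>p\<close> to \<open>0\<close>.\<close>
definition potential :: "nat \<Rightarrow> real vec" where
  "potential p = vec d (\<lambda>r. if r < p then (- 1) ^ (d - (r + 1)) else 0)"

definition column :: "nat \<Rightarrow> real vec" where
  "column a = (if a \<le> d then unit_vec d (a - 1) else potential (k (a - d)))"

abbreviation ground :: "nat set" where
  "ground \<equiv> {1..d + m}"

abbreviation closure :: "nat set \<Rightarrow> nat set" where
  "closure \<equiv> column_closure ground column"

lemma potential_carrier [simp]: "potential p \<in> carrier_vec d"
  by (simp add: potential_def)

lemma column_carrier [simp]: "column a \<in> carrier_vec d"
  by (simp add: column_def)

lemma columns_carrier: "column ` B \<subseteq> carrier_vec d"
  by auto

lemma potential_0: "potential 0 \<in> span (column ` B)"
proof -
  have "potential 0 = 0\<^sub>v d"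
    by (auto simp: potential_def)
  then show ?thesis
    by (intro in_spanI[of _ _ "{}"]) auto
qed

lemma potential_Suc:
  assumes "p < d"
  shows "potential (Suc p) = potential p + (- 1) ^ (d - (p + 1)) \<cdot>\<^sub>v unit_vec d p"
  using assms by (auto simp: potential_def unit_vec_def less_Suc_eq)

lemma span_plus:
  assumes "v \<in> span (column ` B)" "w \<in> span (column ` B)"
  shows "v + w \<in> span (column ` B)"
  using span_add1[of "column ` B", OF _ assms] by (simp add: columns_carrier)

lemma span_smult:
  assumes "v \<in> span (column ` B)"
  shows "c \<cdot>\<^sub>v v \<in> span (column ` B)"
  using smult_in_span[OF columns_carrier assms] .

lemma potential_step_iff:
  assumes e: "unit_vec d p \<in> span (column ` B)" and p: "p < d"
  shows "potential (Suc p) \<in> span (column ` B) \<longleftrightarrow> potential p \<in> span (column ` B)"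
proof
  assume "potential p \<in> span (column ` B)"
  then show "potential (Suc p) \<in> span (column ` B)"
    unfolding potential_Suc[OF p] by (intro span_plus span_smult e)
next
  assume *: "potential (Suc p) \<in> span (column ` B)"
  have "potential p = potential (Suc p) + (- ((- 1) ^ (d - (p + 1)))) \<cdot>\<^sub>v unit_vec d p"
    using p by (auto simp: potential_def unit_vec_def less_Suc_eq)
  then show "potential p \<in> span (column ` B)"
    using span_plus[OF * span_smult[OF e]] by metis
qed

lemma unit_vec_in_span:
  assumes "potential p \<in> span (column ` B)" "potential (Suc p) \<in> span (column ` B)" "p < d"
  shows "unit_vec d p \<in> span (column ` B)"
proof -
  let ?s = "(- 1 :: real) ^ (d - (p + 1))"
  have "?s * ?s = 1"
    by (simp flip: power_mult_distrib)
  then have "unit_vec d p = ?s \<cdot>\<^sub>v potential (Suc p) + (- ?s) \<cdot>\<^sub>v potential p"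
    using assms(3) by (auto simp: potential_def unit_vec_def less_Suc_eq)
  then show ?thesis
    using span_plus[OF span_smult[OF assms(2)] span_smult[OF assms(1)]] by metis
qed

lemma column_in_span: "a \<in> B \<Longrightarrow> column a \<in> span (column ` B)"
  using in_own_span[of "column ` B"] columns_carrier by auto

text \<open>Vertices that are joined by path edges in \<open>B\<close> are connected to \<open>0\<close> through \<open>B\<close> simultaneously.\<close>
lemma potential_path:
  assumes "p \<le> q" "q \<le> d" "{p<..q} \<subseteq> B"
  shows "potential q \<in> span (column ` B) \<longleftrightarrow> potential p \<in> span (column ` B)"
  using assms
proof (induction q rule: dec_induct)
  case (step r)
  have "Suc r \<in> B" "column (Suc r) = unit_vec d r"
    using step by (auto simp: column_def)
  then have "unit_vec d r \<in> span (column ` B)"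
    using column_in_span[of "Suc r" B] by simp
  then show ?case
    using potential_step_iff[of r B] step by (auto simp: subset_iff)
qed simp

lemma potential_from_0:
  assumes "q \<le> d" "{1..q} \<subseteq> B"
  shows "potential q \<in> span (column ` B)"
  using potential_path[of 0 q B] potential_0[of B] assms by (auto simp: subset_iff)

lemma potential_target:
  assumes "j \<in> {1..m}" "d + j \<in> B"
  shows "potential (k j) \<in> span (column ` B)"
  using column_in_span[OF assms(2)] assms(1) by (auto simp: column_def)

lemma span_columns: "span (column ` ground) = carrier_vec d"
proof
  show "span (column ` ground) \<subseteq> carrier_vec d"
    using span_is_subset2[of "column ` ground"] columns_carrier by auto
  have "unit_vec d i \<in> span (column ` ground)" if "i < d" for i
    using column_in_span[of "Suc i" ground] that by (auto simp: column_def)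
  then have "set (unit_vecs d) \<subseteq> span (column ` ground)"
    by (auto simp: unit_vecs_def)
  then show "carrier_vec d \<subseteq> span (column ` ground)"
    using span_least[OF columns_carrier, of "set (unit_vecs d)" ground] span_unit_vecs_is_carrier by simp
qed

text \<open>How non-membership in a closure is shown: if no edge of \<open>B\<close> crosses the cut between the vertex
  set \<open>S\<close> and its complement, which contains \<open>0\<close>, then no edge spanned by \<open>B\<close> does. The reason
  is the vector \<open>c\<close> below, whose inner product with \<open>potential p\<close> is the indicator of \<open>p \<in> S\<close>, so
  that it is orthogonal to exactly those edges that do not cross.\<close>
lemma cut:
  fixes S :: "nat set"
  assumes S: "0 \<notin> S"
    and units: "\<And>b. b \<in> B \<Longrightarrow> b \<le> d \<Longrightarrow> b \<in> S \<longleftrightarrow> b - 1 \<in> S"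
    and targets: "\<And>b. b \<in> B \<Longrightarrow> d < b \<Longrightarrow> k (b - d) \<notin> S"
    and B: "B \<subseteq> ground" and a: "a \<in> closure B"
  shows "if a \<le> d then a \<in> S \<longleftrightarrow> a - 1 \<in> S else k (a - d) \<notin> S"
proof -
  define c where
    "c = vec d (\<lambda>r. (- 1) ^ (d - (r + 1)) * (of_bool (Suc r \<in> S) - of_bool (r \<in> S)) :: real)"
  have c: "c \<in> carrier_vec d"
    by (simp add: c_def)
  have c_unit: "c \<bullet> unit_vec d (b - 1) =
      (- 1) ^ (d - b) * (of_bool (b \<in> S) - of_bool (b - 1 \<in> S))" if "b \<in> {1..d}" for b
    using that c by (auto simp: c_def)
  have sq: "(- 1 :: real) ^ t * (- 1) ^ t = 1" for t
    by (simp flip: power_mult_distrib)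
  have c_potential: "c \<bullet> potential p = of_bool (p \<in> S)" if "p \<le> d" for p
  proof -
    have "c \<bullet> potential p = (\<Sum>r<d. c $ r * potential p $ r)"
      by (simp add: scalar_prod_def potential_def lessThan_atLeast0)
    also have "\<dots> = (\<Sum>r<p. c $ r * potential p $ r)"
      using that by (intro sum.mono_neutral_right) (auto simp: potential_def)
    also have "\<dots> = (\<Sum>r<p. of_bool (Suc r \<in> S) - of_bool (r \<in> S))"
    proof (rule sum.cong)
      fix r assume "r \<in> {..<p}"
      then show "c $ r * potential p $ r = of_bool (Suc r \<in> S) - of_bool (r \<in> S)"
        using that sq[of "d - Suc r"] by (simp add: c_def potential_def algebra_simps)
    qed simp
    also have "\<dots> = of_bool (p \<in> S)"
      using S by (subst sum_lessThan_telescope) simp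
    finally show ?thesis .
  qed
  have "c \<bullet> column b = 0" if b: "b \<in> B" for b
  proof (cases "b \<le> d")
    case True
    then show ?thesis
      using b B units[OF b] c_unit[of b] by (auto simp: column_def)
  next
    case False
    then have "b - d \<in> {1..m}"
      using b B by auto
    then show ?thesis
      using False targets[OF b] c_potential[of "k (b - d)"] k_range by (auto simp: column_def)
  qed
  then have "c \<in> orthogonal_complement (span (column ` B))"
    using c in_orthogonal_complement_span[OF columns_carrier, of B]
    by (auto simp: orthogonal_complement_def)
  then have orth: "c \<bullet> column a = 0"
    using a by (auto simp: orthogonal_complement_def column_closure_def)
  have a_ground: "a \<in> ground"
    using a by (auto simp: column_closure_def)
  show ?thesis
  proof (cases "a \<le> d")
    case True
    then show ?thesis
      using orth c_unit[of a] a_ground by (auto simp: column_def of_bool_def split: if_splits)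
  next
    case False
    then have "a - d \<in> {1..m}"
      using a_ground by auto
    then show ?thesis
      using False orth c_potential[of "k (a - d)"] k_range by (auto simp: column_def)
  qed
qed


section \<open>The order of the columns along the cycle\<close>

sublocale columns: cyclic_exchange_closure "d + m" closure
  unfolding cyclic_exchange_closure_def
  by (rule exchange_closure_columns) auto

text \<open>The cycle walks through the vertices \<open>1, \<dots>, d\<close>. At vertex \<open>p\<close> it lists the path edge that
  enters \<open>p\<close>, namely column \<open>p\<close>, and then the return edges that start at \<open>p\<close> in decreasing order
  of their columns. The order is encoded by a single number whose leading digit in base \<open>m + 1\<close> is
  the vertex; \<open>offset\<close> takes the value \<open>0\<close> only on path edges.\<close>

definition head :: "nat \<Rightarrow> nat" where
  "head a = (if a \<le> d then a else k (a - d))"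

definition offset :: "nat \<Rightarrow> nat" where
  "offset a = (if a \<le> d then 0 else m + 1 - (a - d))"

definition key :: "nat \<Rightarrow> nat" where
  "key a = head a * (m + 1) + offset a"

lemma head_range: "a \<in> ground \<Longrightarrow> 1 \<le> head a \<and> head a \<le> d"
  using k_range[of "a - d"] by (cases "a \<le> d") (simp_all add: head_def le_diff_conv)

lemma key_less_iff:
  assumes "a \<in> ground" "b \<in> ground"
  shows "key a < key b \<longleftrightarrow> head a < head b \<or> head a = head b \<and> offset a < offset b"
proof -
  have less: "x * (m + 1) + u < y * (m + 1) + v" if "x < y" "u \<le> m" for x y u v :: nat
  proof -
    have "(x + 1) * (m + 1) \<le> y * (m + 1)"
      using that(1) by (intro mult_le_mono1) simp
    then show ?thesis
      using that(2) by simp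
  qed
  have "offset a \<le> m" "offset b \<le> m"
    by (auto simp: offset_def)
  then show ?thesis
    using less[of "head a" "head b" "offset a" "offset b"] less[of "head b" "head a" "offset b" "offset a"]
    by (cases "head a" "head b" rule: linorder_cases) (auto simp: key_def)
qed

lemma inj_on_key: "inj_on key ground"
proof (rule inj_onI)
  fix a b assume ab: "a \<in> ground" "b \<in> ground" "key a = key b"
  then have "head a = head b" "offset a = offset b"
    using key_less_iff[of a b] key_less_iff[of b a] by auto
  then show "a = b"
    using ab by (auto simp: head_def offset_def split: if_splits)
qed

definition successive :: "nat \<Rightarrow> nat \<Rightarrow> bool" where
  "successive x y \<longleftrightarrow> x \<in> ground \<and> y \<in> ground \<and>
     key x < key y \<and> (\<forall>z\<in>ground. \<not> (key x < key z \<and> key z < key y))"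

lemma replaced_byI:
  assumes x: "x \<in> ground" and y: "y \<in> ground"
    and mem: "column y \<in> span (column ` {b \<in> ground. b \<noteq> y \<and> cyc_pos (d + m) y b \<le> cyc_pos (d + m) y x})"
    and notin: "y \<notin> closure {b \<in> ground. b \<noteq> y \<and> cyc_pos (d + m) y b < cyc_pos (d + m) y x}"
  shows "columns.replaced_by (cyc_pos (d + m) y) y x"
  using assms unfolding columns.replaced_by_def column_closure_def by blast

text \<open>Let \<open>y\<close> be the path edge \<open>{y - 1, y}\<close>. In the order starting after \<open>y\<close>, the path edges
  \<open>y + 1, \<dots>, d\<close> and the return edge \<open>d + 1\<close>, which starts at \<open>k 1 = d\<close>, connect \<open>y\<close> to \<open>0\<close>. It
  remains to reach \<open>y - 1\<close>. The first edge to do so is the first return edge that starts at \<open>y - 1\<close>,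
  which is the last element listed at that vertex; or, if there is none, the path edge \<open>y - 1\<close>,
  which completes the path from \<open>0\<close>. Until then the edge \<open>y\<close> is
  the only one at the vertex \<open>y - 1\<close>, so that the cut \<open>S = {y - 1}\<close> applies.\<close>
lemma successive_path_edge:
  assumes xy: "successive x y" and y: "2 \<le> y" "y \<le> d"
  shows "columns.replaced_by (cyc_pos (d + m) y) y x" and "x < y \<longleftrightarrow> x \<le> d"
proof -
  have x_in: "x \<in> ground" and y_in: "y \<in> ground" and py: "y - 1 \<in> ground"
    using xy y by (auto simp: successive_def)
  note less = key_less_iff[OF x_in y_in]
  have gap: "\<not> (key x < key z \<and> key z < key y)" if "z \<in> ground" for z
    using xy that by (auto simp: successive_def)
  have hy: "head y = y" "offset y = 0" "head (y - 1) = y - 1" "offset (y - 1) = 0"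
    using y by (auto simp: head_def offset_def)
  have hx: "head x = y - 1"
    using xy less gap[OF py] key_less_iff[OF x_in py] key_less_iff[OF py y_in] hy y
    by (auto simp: successive_def)
  have first: "d < x \<and> x \<le> z" if z: "z \<in> ground" "d < z" "k (z - d) = y - 1" for z
  proof -
    have "head z = y - 1" "0 < offset z"
      using z by (auto simp: head_def offset_def)
    then have "offset z \<le> offset x"
      using gap[OF z(1)] key_less_iff[OF x_in z(1)] key_less_iff[OF z(1) y_in] hx hy y by auto
    then show ?thesis
      using \<open>0 < offset z\<close> x_in z by (auto simp: offset_def split: if_splits)
  qed
  have x_cases: "x = y - 1 \<or> d < x"
    using hx by (auto simp: head_def split: if_splits)
  then show "x < y \<longleftrightarrow> x \<le> d"
    using y by auto
  note pos = cyc_pos_eq[OF y_in]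
  let ?le = "{b \<in> ground. b \<noteq> y \<and> cyc_pos (d + m) y b \<le> cyc_pos (d + m) y x}"
  let ?lt = "{b \<in> ground. b \<noteq> y \<and> cyc_pos (d + m) y b < cyc_pos (d + m) y x}"
  show "columns.replaced_by (cyc_pos (d + m) y) y x"
  proof (rule replaced_byI[OF x_in y_in])
    have later: "b \<in> ?le" if "y < b" "b \<le> d + 1" for b
    proof -
      have "b \<in> ground"
        using that y m_pos by auto
      then show ?thesis
        using that x_cases x_in y by (auto simp: pos[OF x_in] pos)
    qed
    have "potential d \<in> span (column ` ?le)"
      using potential_target[of 1 ?le] later[of "d + 1"] m_pos y k_first by simp
    then have y_span: "potential y \<in> span (column ` ?le)"
      using potential_path[of y d ?le] later y by (auto simp: subset_iff)
    have "potential (y - 1) \<in> span (column ` ?le)"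
    proof (cases "d < x")
      case True
      then have "potential (k (x - d)) \<in> span (column ` ?le)"
        using x_in y by (intro potential_target) auto
      then show ?thesis
        using hx True by (simp add: head_def)
    next
      case False
      then have "x = y - 1"
        using x_cases by simp
      then have "b \<in> ?le" if "b \<in> {1..y - 1}" for b
      proof -
        have "b \<in> ground"
          using that y by auto
        then show ?thesis
          using that y x_in \<open>x = y - 1\<close> by (auto simp: pos[OF x_in] pos)
      qed
      then show ?thesis
        using y by (intro potential_from_0) auto
    qed
    then show "column y \<in> span (column ` ?le)"
      using unit_vec_in_span[of "y - 1" ?le] y_span y by (simp add: column_def)
    show "y \<notin> closure ?lt"
    proof
      assume "y \<in> closure ?lt"
      have "if y \<le> d then y \<in> {y - 1} \<longleftrightarrow> y - 1 \<in> {y - 1} else k (y - d) \<notin> {y - 1}"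
      proof (rule cut[OF _ _ _ _ \<open>y \<in> closure ?lt\<close>])
        fix b assume b: "b \<in> ?lt" "b \<le> d"
        have "cyc_pos (d + m) y (y - 1) = d + m - 1"
          using y by (simp add: pos[OF py] del: One_nat_def)
        moreover have "cyc_pos (d + m) y x < d + m"
          using d_pos by (simp add: cyc_pos_def)
        ultimately have "b \<noteq> y - 1"
          using b by auto
        then show "b \<in> {y - 1} \<longleftrightarrow> b - 1 \<in> {y - 1}"
          using b y by auto
      next
        fix b assume b: "b \<in> ?lt" "d < b"
        show "k (b - d) \<notin> {y - 1}"
        proof
          assume "k (b - d) \<in> {y - 1}"
          then have "d < x" "x \<le> b"
            using first[of b] b by auto
          then have "cyc_pos (d + m) y x \<le> cyc_pos (d + m) y b"
            using b y by (auto simp: pos[OF x_in] pos)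
          then show False
            using b by auto
        qed
      qed (use y in auto)
      then show False
        using y by auto
    qed
  qed
qed

text \<open>Let \<open>y\<close> be the return edge \<open>{0, p}\<close>. If the next column is parallel to it, that column
  replaces \<open>y\<close> and precedes it in the list at \<open>p\<close>. Otherwise, as \<open>k\<close> is weakly decreasing, all later return
  edges start at vertices below \<open>p\<close>, and \<open>p\<close> is reached from \<open>0\<close> only when the path
  \<open>1, \<dots>, p\<close> is complete, so that \<open>y\<close> is replaced by the path edge \<open>p\<close>. Before that, nothing
  crosses the cut \<open>S = {p..d}\<close>.\<close>
lemma successive_return_edge:
  assumes xy: "successive x y" and y: "d < y"
  shows "columns.replaced_by (cyc_pos (d + m) y) y x" and "x < y \<longleftrightarrow> x \<le> d"
proof -
  define p where "p = k (y - d)"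
  have x_in: "x \<in> ground" and y_in: "y \<in> ground"
    using xy by (auto simp: successive_def)
  have p: "1 \<le> p" "p \<le> d"
    using k_range[of "y - d"] y y_in by (simp_all add: p_def le_diff_conv)
  then have p_in: "p \<in> ground"
    by auto
  note less = key_less_iff[OF x_in y_in]
  have gap: "\<not> (key x < key z \<and> key z < key y)" if "z \<in> ground" for z
    using xy that by (auto simp: successive_def)
  \<comment> \<open>The path edge \<open>p\<close> opens the list of vertex \<open>p\<close>, so the predecessor \<open>x\<close> of \<open>y\<close> is in that list.\<close>
  have h: "head y = p" "0 < offset y" "head p = p" "offset p = 0"
    using y y_in p by (auto simp: head_def offset_def p_def)
  have hx: "head x = p" and ox: "offset x < offset y"
    using xy less gap[OF p_in] key_less_iff[OF x_in p_in] key_less_iff[OF p_in y_in] h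
    by (auto simp: successive_def)
  have x_cases: "x = p \<or> y < x"
    using hx ox y by (auto simp: head_def offset_def split: if_splits)
  then show "x < y \<longleftrightarrow> x \<le> d"
    using y p by auto
  have next_parallel: "d < x \<and> x \<le> z" if z: "z \<in> ground" "y < z" "k (z - d) = p" for z
  proof -
    have "head z = p" "offset z < offset y" "0 < offset z"
      using z y by (auto simp: head_def offset_def)
    then have "offset z \<le> offset x"
      using gap[OF z(1)] key_less_iff[OF x_in z(1)] key_less_iff[OF z(1) y_in] hx h by auto
    then show ?thesis
      using \<open>0 < offset z\<close> x_in z by (auto simp: offset_def split: if_splits)
  qed
  note pos = cyc_pos_eq[OF y_in]
  let ?le = "{b \<in> ground. b \<noteq> y \<and> cyc_pos (d + m) y b \<le> cyc_pos (d + m) y x}"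
  let ?lt = "{b \<in> ground. b \<noteq> y \<and> cyc_pos (d + m) y b < cyc_pos (d + m) y x}"
  show "columns.replaced_by (cyc_pos (d + m) y) y x"
  proof (rule replaced_byI[OF x_in y_in])
    have "potential p \<in> span (column ` ?le)"
    proof (cases "d < x")
      case True
      then have "potential (k (x - d)) \<in> span (column ` ?le)"
        using x_in ox by (intro potential_target) auto
      then show ?thesis
        using hx True by (simp add: head_def)
    next
      case False
      then have "x = p"
        using x_cases y by simp
      then have "b \<in> ?le" if "b \<in> {1..p}" for b
      proof -
        have "b \<in> ground"
          using that p by auto
        then show ?thesis
          using that y p x_in \<open>x = p\<close> by (auto simp: pos[OF x_in] pos)
      qed
      then show ?thesis
        using p y by (intro potential_from_0) auto
    qed
    then show "column y \<in> span (column ` ?le)"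
      using y by (simp add: column_def p_def)
    show "y \<notin> closure ?lt"
    proof
      assume "y \<in> closure ?lt"
      have "if y \<le> d then y \<in> {p..d} \<longleftrightarrow> y - 1 \<in> {p..d} else k (y - d) \<notin> {p..d}"
      proof (rule cut[OF _ _ _ _ \<open>y \<in> closure ?lt\<close>])
        fix b assume b: "b \<in> ?lt" "b \<le> d"
        then have "b < p"
          using x_cases x_in y y_in p by (auto simp: pos[OF x_in] pos)
        then show "b \<in> {p..d} \<longleftrightarrow> b - 1 \<in> {p..d}"
          by auto
      next
        fix b assume b: "b \<in> ?lt" "d < b"
        then have b_in: "b \<in> ground"
          by simp
        have "y < b"
          using b x_cases x_in y y_in p by (auto simp: pos[OF x_in] pos[OF b_in] split: if_splits)
        then have "k (b - d) \<le> p"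
          unfolding p_def using y b_in y_in by (intro k_antimono) auto
        moreover have "k (b - d) \<noteq> p"
        proof
          assume "k (b - d) = p"
          then have "d < x" "x \<le> b"
            using next_parallel[of b] b_in \<open>y < b\<close> by auto
          then have "cyc_pos (d + m) y x \<le> cyc_pos (d + m) y b"
            using \<open>y < b\<close> x_cases p y by (auto simp: pos[OF x_in] pos[OF b_in])
          then show False
            using b by auto
        qed
        ultimately show "k (b - d) \<notin> {p..d}"
          by auto
      qed (use p in auto)
      then show False
        using y p by (auto simp: p_def)
    qed
  qed
qed

text \<open>The path edge \<open>{0, 1}\<close> is replaced as soon as the cycle formed by the path and the return edge
  \<open>d + 1\<close> from \<open>k 1 = d\<close> is complete.\<close>
lemma closing_edge: "columns.replaced_by (cyc_pos (d + m) 1) 1 (d + 1)"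
proof -
  have x_in: "d + 1 \<in> ground" and y_in: "1 \<in> ground"
    using m_pos by auto
  note pos = cyc_pos_eq[OF y_in]
  let ?le = "{b \<in> ground. b \<noteq> 1 \<and> cyc_pos (d + m) 1 b \<le> cyc_pos (d + m) 1 (d + 1)}"
  let ?lt = "{b \<in> ground. b \<noteq> 1 \<and> cyc_pos (d + m) 1 b < cyc_pos (d + m) 1 (d + 1)}"
  have le: "?le = {1<..d + 1}" and lt: "?lt = {1<..d}"
    using m_pos by (auto simp: pos[OF x_in] pos simp del: One_nat_def)
  show ?thesis
  proof (rule replaced_byI[OF x_in y_in])
    have "potential d \<in> span (column ` ?le)"
      unfolding le using potential_target[of 1 "{1<..d + 1}"] m_pos d_pos k_first by simp
    then have "potential 1 \<in> span (column ` ?le)"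
      unfolding le using potential_path[of 1 d "{1<..d + 1}"] d_pos by (simp add: subset_iff)
    then show "column 1 \<in> span (column ` ?le)"
      using unit_vec_in_span[of 0 ?le] potential_0[of ?le] d_pos by (simp add: column_def)
    show "1 \<notin> closure ?lt"
      unfolding lt
    proof
      assume in_cl: "1 \<in> closure {1<..d}"
      have "if 1 \<le> d then 1 \<in> {1..d} \<longleftrightarrow> 1 - 1 \<in> {1..d} else k (1 - d) \<notin> {1..d}"
        by (rule cut[OF _ _ _ _ in_cl]) auto
      then show False
        using d_pos by simp
    qed
  qed
qed

text \<open>The cycle starts with column \<open>1\<close> and ends with column \<open>d + 1\<close>, the last one in the list at
  vertex \<open>d\<close>. At each path edge it moves on to a larger column: either to the next path edge or to a
  return edge. At each return edge it moves to a smaller column, which is a parallel return edge with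
  smaller index, the next path edge, or \<open>1\<close>. So exactly the path edges are weak excedances.\<close>
lemma decorated_permutation_of_columns:
  shows "full_cycle (d + m) (fst (decorated_permutation_of (d + m) columns.bases))"
    and "weak_excedances (d + m) (decorated_permutation_of (d + m) columns.bases) = {1..d}"
proof -
  define cs where "cs = sorted_key_list_of_set key ground"
  have set_cs: "set cs = ground" and sorted: "sorted_wrt (\<lambda>a b. key a < key b) cs"
    using sorted_key_list_of_set_strict[OF inj_on_key] by (simp_all add: cs_def)
  have dist: "distinct cs"
    using sorted distinct_map[of key cs] by (simp add: sorted_wrt_map strict_sorted_iff flip: sorted_wrt_map)
  have len: "length cs = d + m"
    using distinct_card[OF dist] set_cs by simp
  have mono: "key (cs ! s) < key (cs ! t)" if "s < t" "t < d + m" for s t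
    using sorted_wrt_nth_less[OF sorted] that len by simp
  have at_in: "cs ! t \<in> ground" if "t < d + m" for t
    using nth_mem[of t cs] that len set_cs by simp
  have at: "\<exists>t<d + m. cs ! t = a" if "a \<in> ground" for a
    using that len unfolding set_cs[symmetric] in_set_conv_nth by auto
  have first: "cs ! 0 = 1"
  proof -
    obtain t where t: "t < d + m" "cs ! t = 1"
      using at[of 1] d_pos by auto
    have "head 1 = 1" "offset 1 = 0"
      using d_pos by (simp_all add: head_def offset_def)
    then have "\<not> key (cs ! 0) < key 1"
      using key_less_iff[of "cs ! 0" 1] head_range[of "cs ! 0"] at_in[of 0] d_pos by auto
    then show ?thesis
      using mono[of 0 t] t by (cases "t = 0") auto
  qed
  have last: "cs ! (d + m - 1) = d + 1"
  proof -
    obtain t where t: "t < d + m" "cs ! t = d + 1"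
      using at[of "d + 1"] m_pos by auto
    let ?z = "cs ! (d + m - 1)"
    have z: "?z \<in> ground"
      using at_in[of "d + m - 1"] d_pos by simp
    have "head (d + 1) = d" "offset (d + 1) = m" "offset ?z \<le> m"
      using k_first by (auto simp: head_def offset_def)
    then have max: "\<not> key (d + 1) < key ?z"
      using key_less_iff[of "d + 1" ?z] head_range[OF z] z m_pos by auto
    have "\<not> t < d + m - 1"
    proof
      assume "t < d + m - 1"
      then have "key (cs ! t) < key ?z"
        by (intro mono) auto
      then show False
        using max t(2) by simp
    qed
    then have "t = d + m - 1"
      using t(1) by simp
    then show ?thesis
      using t(2) by simp
  qed
  have step: "columns.replaced_by (cyc_pos (d + m) (cs ! (Suc t mod (d + m)))) (cs ! (Suc t mod (d + m))) (cs ! t)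
      \<and> (cs ! t < cs ! (Suc t mod (d + m)) \<longleftrightarrow> cs ! t \<le> d)" if t: "t < d + m" for t
  proof (cases "Suc t = d + m")
    case True
    then have "t = d + m - 1"
      by simp
    then have "cs ! t = d + 1"
      using last by simp
    moreover have "cs ! (Suc t mod (d + m)) = 1"
      using True first by simp
    ultimately show ?thesis
      using closing_edge by simp
  next
    case False
    then have t': "Suc t < d + m"
      using t by simp
    define x y where "x = cs ! t" and "y = cs ! Suc t"
    have "successive x y"
      unfolding successive_def
    proof (intro conjI ballI)
      show "x \<in> ground" "y \<in> ground" "key x < key y"
        using at_in t' mono by (auto simp: x_def y_def)
      fix z assume "z \<in> ground"
      then obtain s where s: "s < d + m" "z = cs ! s"
        using at by blast
      then show "\<not> (key x < key z \<and> key z < key y)"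
        using mono[of s t] mono[of "Suc t" s] t t' unfolding x_def y_def
        by (cases s t rule: linorder_cases; cases "s = Suc t") auto
    qed
    moreover have "y \<noteq> 1"
      using mono[of 0 "Suc t"] t' first by (auto simp: y_def)
    moreover have "y \<in> ground"
      using at_in t' by (simp add: y_def)
    ultimately show ?thesis
      using successive_path_edge[of x y] successive_return_edge[of x y] t'
      by (cases "y \<le> d") (auto simp: x_def y_def)
  qed
  have eq: "decorated_permutation_of (d + m) columns.bases = (cycle_of_list cs, \<lambda>_. None)"
    by (rule columns.decorated_permutation_of_cycle[OF dist set_cs]) (use step d_pos m_pos in auto)
  show "full_cycle (d + m) (fst (decorated_permutation_of (d + m) columns.bases))"
    unfolding eq full_cycle_def using dist len set_cs by auto
  have "j < cycle_of_list cs j \<longleftrightarrow> j \<le> d" if "j \<in> ground" for j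
  proof -
    obtain t where "t < d + m" "cs ! t = j"
      using at[OF \<open>j \<in> ground\<close>] by blast
    then show ?thesis
      using step[of t] nth_cycle_of_list[OF dist, of t] len by simp
  qed
  then show "weak_excedances (d + m) (decorated_permutation_of (d + m) columns.bases) = {1..d}"
    unfolding eq weak_excedances_def by auto
qed

end


section \<open>From Dyck paths to columns\<close>

lemma length_east_heights_from: "length (east_heights_from y p) = count_list p East"
  by (induction y p rule: east_heights_from.induct) auto

lemma sorted_east_heights_from:
  "sorted (east_heights_from y p) \<and> (\<forall>h\<in>set (east_heights_from y p). y \<le> h)"
  by (induction y p rule: east_heights_from.induct) force+

text \<open>The point at which the horizontal step \<open>j\<close> (counted from \<open>0\<close>) starts is reached by a prefix
  of the path with \<open>j\<close> horizontal steps, so that the Dyck condition applies to its height.\<close>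
lemma east_heights_from_prefix:
  assumes "j < count_list p East"
  shows "\<exists>t\<le>length p. count_list (take t p) East = j \<and>
    east_heights_from y p ! j = y + count_list (take t p) North"
  using assms
proof (induction y p arbitrary: j rule: east_heights_from.induct)
  case (2 y p)
  show ?case
  proof (cases j)
    case 0
    then show ?thesis
      by (intro exI[of _ 0]) simp
  next
    case (Suc i)
    then obtain t where "t \<le> length p" "count_list (take t p) East = i"
      "east_heights_from y p ! i = y + count_list (take t p) North"
      using 2 by auto
    then show ?thesis
      using Suc by (intro exI[of _ "Suc t"]) simp
  qed
next
  case (3 y p)
  then obtain t where "t \<le> length p" "count_list (take t p) East = j"
    "east_heights_from (Suc y) p ! j = Suc y + count_list (take t p) North"
    by auto
  then show ?case
    by (intro exI[of _ "Suc t"]) simp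
qed simp

lemma dyck_path_east_height_le:
  assumes p: "dyck_path m d p" and j: "j \<in> {1..m}"
  shows "east_height p j * m \<le> d * (j - 1)"
proof -
  have "j - 1 < count_list p East"
    using p j by (auto simp: dyck_path_def)
  then obtain t where t: "t \<le> length p" "count_list (take t p) East = j - 1"
    "east_height p j = count_list (take t p) North"
    using east_heights_from_prefix[of "j - 1" p 0] by (auto simp: east_height_def)
  then have "real (east_height p j) \<le> real d / real m * real (j - 1)"
    using p unfolding dyck_path_def by metis
  then have "real (east_height p j) * real m \<le> real d * real (j - 1)"
    using j by (simp add: field_simps)
  then show ?thesis
    by (simp only: of_nat_mult[symmetric] of_nat_le_iff)
qed

lemma east_height_mono:
  assumes "dyck_path m d p" "i \<in> {1..m}" "j \<in> {1..m}" "i \<le> j"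
  shows "east_height p i \<le> east_height p j"
  unfolding east_height_def
  using assms sorted_east_heights_from[of 0 p]
  by (intro sorted_nth_mono) (auto simp: length_east_heights_from dyck_path_def)

text \<open>The diagonal is used twice: it forces height \<open>0\<close> on the first horizontal step, so that \<open>k 1 = d\<close>,
  and a height below \<open>d\<close> on all of them, so that no \<open>k j\<close> vanishes.\<close>
lemma dyck_columns_of_path:
  assumes p: "dyck_path m d p" and "1 \<le> d" "1 \<le> m"
  shows "dyck_columns d m (\<lambda>j. d - east_height p j)"
proof
  show "1 \<le> d" "1 \<le> m" by fact+
  show "d - east_height p 1 = d"
    using dyck_path_east_height_le[OF p, of 1] assms by simp
  show "1 \<le> d - east_height p j \<and> d - east_height p j \<le> d" if j: "j \<in> {1..m}" for j
  proof -
    have "east_height p j * m \<le> d * (j - 1)"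
      using dyck_path_east_height_le[OF p j] .
    also have "\<dots> < d * m"
      using j \<open>1 \<le> d\<close> by auto
    finally have "east_height p j < d"
      by simp
    then show ?thesis
      by simp
  qed
  show "d - east_height p j \<le> d - east_height p i"
    if "i \<in> {1..m}" "j \<in> {1..m}" "i \<le> j" for i j
    using east_height_mono[OF p that] by (rule diff_le_mono2)
qed

theorem proposition4p4:
  fixes d m :: nat and P :: "nat set set"
  assumes "d \<ge> 1" and "m \<ge> 1"
    and "rational_dyck_positroid d m P"
  shows "full_cycle (d + m) (fst (decorated_permutation_of (d + m) P)) \<and>
         weak_excedances (d + m) (decorated_permutation_of (d + m) P) = {1..d}"
proof -
  obtain A p where P: "P = matroid_of_matrix d (d + m) (phi d m A)"
    and p: "dyck_path m d p"
    and A: "\<And>i j. i \<in> {1..d} \<Longrightarrow> j \<in> {1..m} \<Longrightarrow>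
      A $$ (i - 1, j - 1) = (if i \<le> east_height p j then 0 else 1)"
    using assms(3) unfolding rational_dyck_positroid_def dyck_matrices_def by blast
  interpret dyck_columns d m "\<lambda>j. d - east_height p j"
    using dyck_columns_of_path[OF p assms(1,2)] .
  have carrier: "phi d m A \<in> carrier_mat d (d + m)"
    by (simp add: phi_def)
  have col_eq: "col (phi d m A) (a - 1) = column a" if a: "a \<in> ground" for a
  proof (cases "a \<le> d")
    case True
    then show ?thesis
      using a by (auto simp: phi_def column_def)
  next
    case False
    \<comment> \<open>Row \<open>r\<close> of the right block comes from row \<open>d - r\<close> of the Dyck matrix, counted from \<open>1\<close>; its
      entry is nonzero iff \<open>d - r\<close> exceeds the height.\<close>
    have "A $$ (d - Suc r, a - Suc d) = (if r < d - east_height p (a - d) then 1 else 0)" if "r < d" for r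
    proof -
      have "d - r \<in> {1..d}" "a - d \<in> {1..m}"
        using a False that by auto
      then show ?thesis
        using A[of "d - r" "a - d"] that by auto
    qed
    then show ?thesis
      using a False by (auto simp: phi_def column_def potential_def)
  qed
  have "P = columns.bases"
    unfolding P using carrier col_eq span_columns by (rule matroid_of_matrix_eq_bases)
  then show ?thesis
    using decorated_permutation_of_columns by simp
qed

end
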